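(* Let $\mathbf C=(C,\leq,\odot,\rightarrow,{}',0,1)$ be a commutative unsharp residuated poset and define, for $x,y\in C$, $x+y:=(x'\odot y')'$, defined if and only if $x\leq y'$. Then $(C,+,{}',0,1)$ is an effect algebra whose induced order coincides with $\leq$.
   Context: For a poset $(P,\leq)$ and $A\subseteq P$: $L(A)=\{x\in P\mid x\leq y\ \forall y\in A\}$, $U(A)=\{x\in P\mid y\leq x\ \forall y\in A\}$; we write $L(a,b)=L(\{a,b\})$, $U(a,b)=U(\{a,b\})$, $LU(A)=L(U(A))$, $UL(a,b)=U(L(\{a,b\}))$. For subsets $A,B$, $A\leq B$ means $x\leq y$ for all $x\in A,y\in B$. Operations are extended elementwise to subsets, e.g. $A\odot y=\{u\odot y\mid u\in A\}$. A partial monoid $(A,\odot,1)$ is a set with a partial binary operation such that $(x\odot y)\odot z$ is defined iff $x\odot(y\odot z)$ is defined and then they are equal, and $x\odot1=1\odot x=x$ for all $x$; it is commutative if $x\odot y$ is defined iff $y\odot x$ is defined and then $x\odot y=y\odot x$. A commutative unsharp residuated poset is a tuple $(C,\leq,\odot,\rightarrow,{}',0,1)$ with $\rightarrow:C^2\to 2^C$ such that for all $x,y,z\in C$: (C1) $(C,\leq,{}',0,1)$ is a bounded poset with an antitone involution ${}'$; (C2) $(C,\odot,1)$ is a commutative partial monoid in which $x\odot y$ is defined iff $x'\leq y$, and $z'\leq x\leq y$ implies $x\odot z\leq y\odot z$; (C3) $L(U(x,y')\odot y)\leq UL(y,z)$ if and only if $LU(x,y')\leq U(y\rightarrow z)$;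 (C4) $x\rightarrow 0=\{x'\}$. An effect algebra is a partial algebra $(E,+,{}',0,1)$ of type $(2,1,0,0)$ where $(E,{}',0,1)$ is an algebra and $+$ is a partial binary operation such that for all $x,y,z\in E$: (E1) $x+y$ is defined iff $y+x$ is defined, and then $x+y=y+x$; (E2) $(x+y)+z$ is defined iff $x+(y+z)$ is defined, and then they are equal; (E3) $x'$ is the unique $u\in E$ with $x+u=1$; (E4) if $1+x$ is defined then $x=0$. Its induced order is $x\leq y$ iff there is $z$ with $x+z=y$. *)

theory Defs
  imports Main
begin

text \<open>
  Carriers are sets, and a partial order is a relation \<open>r\<close> on the carrier, so the cones
  $L(A)$ and $U(A)$ of the whole poset are \<open>Under r A\<close> and \<open>Above r A\<close>.
  Partial operations return \<open>None\<close> where they are undefined.  Equality of two \<open>option\<close>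
  values therefore says: one side is defined iff the other is, and then they are equal.
\<close>

locale partial_monoid =
  fixes A :: "'a set"
    and mult :: "'a \<Rightarrow> 'a \<Rightarrow> 'a option"
    and one :: 'a
  assumes one_closed: "one \<in> A"
    and mult_closed: "\<lbrakk>x \<in> A; y \<in> A; mult x y = Some z\<rbrakk> \<Longrightarrow> z \<in> A"
    and mult_assoc: "\<lbrakk>x \<in> A; y \<in> A; z \<in> A\<rbrakk> \<Longrightarrow>
      Option.bind (mult x y) (\<lambda>u. mult u z) = Option.bind (mult y z) (\<lambda>v. mult x v)"
    and mult_one_right: "x \<in> A \<Longrightarrow> mult x one = Some x"
    and mult_one_left: "x \<in> A \<Longrightarrow> mult one x = Some x"

locale comm_partial_monoid = partial_monoid +
  assumes mult_commute: "\<lbrakk>x \<in> A; y \<in> A\<rbrakk> \<Longrightarrow> mult x y = mult y x"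

locale bounded_involution_poset =
  fixes C :: "'a set"
    and r :: "'a rel"
    and neg :: "'a \<Rightarrow> 'a"
    and zero one :: 'a
  assumes partial_order: "partial_order_on C r"
    and zero_closed: "zero \<in> C"
    and one_closed: "one \<in> C"
    and zero_least: "x \<in> C \<Longrightarrow> (zero, x) \<in> r"
    and one_greatest: "x \<in> C \<Longrightarrow> (x, one) \<in> r"
    and neg_closed: "x \<in> C \<Longrightarrow> neg x \<in> C"
    and neg_neg: "x \<in> C \<Longrightarrow> neg (neg x) = x"
    and neg_antitone: "\<lbrakk>x \<in> C; y \<in> C; (x, y) \<in> r\<rbrakk> \<Longrightarrow> (neg y, neg x) \<in> r"

definition set_le :: "'a rel \<Rightarrow> 'a set \<Rightarrow> 'a set \<Rightarrow> bool" where
  "set_le r A B \<longleftrightarrow> (\<forall>x\<in>A. \<forall>y\<in>B. (x, y) \<in> r)"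

text \<open>
  The elementwise extension of a partial operation collects the defined products; in the
  residuation law below it is only applied where every product is defined.
\<close>

definition set_mult :: "('a \<Rightarrow> 'a \<Rightarrow> 'a option) \<Rightarrow> 'a set \<Rightarrow> 'a \<Rightarrow> 'a set" where
  "set_mult mult A y = {v. \<exists>u\<in>A. mult u y = Some v}"

locale comm_unsharp_residuated_poset =
  fixes C :: "'a set"
    and r :: "'a rel"
    and mult :: "'a \<Rightarrow> 'a \<Rightarrow> 'a option"
    and imp :: "'a \<Rightarrow> 'a \<Rightarrow> 'a set"
    and neg :: "'a \<Rightarrow> 'a"
    and zero one :: 'a
  assumes bounded_involution_poset: "bounded_involution_poset C r neg zero one"
    and comm_partial_monoid: "comm_partial_monoid C mult one"
    and imp_closed: "\<lbrakk>x \<in> C; y \<in> C\<rbrakk> \<Longrightarrow> imp x y \<subseteq> C"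
    and mult_defined_iff: "\<lbrakk>x \<in> C; y \<in> C\<rbrakk> \<Longrightarrow> mult x y \<noteq> None \<longleftrightarrow> (neg x, y) \<in> r"
    and mult_mono: "\<lbrakk>x \<in> C; y \<in> C; z \<in> C; (neg z, x) \<in> r; (x, y) \<in> r;
      mult x z = Some u; mult y z = Some v\<rbrakk> \<Longrightarrow> (u, v) \<in> r"
    and residuation: "\<lbrakk>x \<in> C; y \<in> C; z \<in> C\<rbrakk> \<Longrightarrow>
      set_le r (Under r (set_mult mult (Above r {x, neg y}) y)) (Above r (Under r {y, z}))
      \<longleftrightarrow> set_le r (Under r (Above r {x, neg y})) (Above r (imp y z))"
    and imp_zero: "x \<in> C \<Longrightarrow> imp x zero = {neg x}"

locale effect_algebra =
  fixes E :: "'a set"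
    and add :: "'a \<Rightarrow> 'a \<Rightarrow> 'a option"
    and neg :: "'a \<Rightarrow> 'a"
    and zero one :: 'a
  assumes zero_closed: "zero \<in> E"
    and one_closed: "one \<in> E"
    and neg_closed: "x \<in> E \<Longrightarrow> neg x \<in> E"
    and add_closed: "\<lbrakk>x \<in> E; y \<in> E; add x y = Some z\<rbrakk> \<Longrightarrow> z \<in> E"
    and add_commute: "\<lbrakk>x \<in> E; y \<in> E\<rbrakk> \<Longrightarrow> add x y = add y x"
    and add_assoc: "\<lbrakk>x \<in> E; y \<in> E; z \<in> E\<rbrakk> \<Longrightarrow>
      Option.bind (add x y) (\<lambda>u. add u z) = Option.bind (add y z) (\<lambda>v. add x v)"
    and add_eq_one_iff: "\<lbrakk>x \<in> E; u \<in> E\<rbrakk> \<Longrightarrow> add x u = Some one \<longleftrightarrow> u = neg x"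
    and one_add_defined: "\<lbrakk>x \<in> E; add one x \<noteq> None\<rbrakk> \<Longrightarrow> x = zero"

definition induced_order :: "'a set \<Rightarrow> ('a \<Rightarrow> 'a \<Rightarrow> 'a option) \<Rightarrow> 'a rel" where
  "induced_order E add = {(x, y). x \<in> E \<and> y \<in> E \<and> (\<exists>z\<in>E. add x z = Some y)}"

text \<open>
  The sum $x + y = (x' \odot y')'$ with domain $x \leq y'$.  The product of $x'$ and $y'$ is
  defined precisely there; the factor $y'$ (rather than $y$) is essential, since with $y$ one
  would get $0 + 0 = (1 \odot 0)' = 1$.
\<close>

definition dual_add ::
  "'a rel \<Rightarrow> ('a \<Rightarrow> 'a \<Rightarrow> 'a option) \<Rightarrow> ('a \<Rightarrow> 'a) \<Rightarrow> 'a \<Rightarrow> 'a \<Rightarrow> 'a option" where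
  "dual_add r mult neg x y =
    (if (x, neg y) \<in> r then map_option neg (mult (neg x) (neg y)) else None)"

end

theory Submission imports Defs begin

text \<open>
  Taking \<open>z = 0\<close> in the residuation law gives, for $y' \leq x$, that
  $x \odot y = 0$ iff $x = y'$: monotonicity makes $x \odot y$ the least element of
  $U(x,y') \odot y$, and $y \rightarrow 0 = \{y'\}$.  Dually $x + u = 1$ iff $u = x'$.
  The remaining axioms transfer from $\odot$ along the involution, and the order is recovered
  from associativity by splitting $1$ into three summands.
\<close>

context effect_algebra
begin

text \<open>The witness is the complement \<open>w\<close> of \<open>s = x + y'\<close>. Regrouping
  \<open>(y' + x) + w = 1\<close> as \<open>y' + (x + w) = 1\<close> makes \<open>x + w\<close> a
  complement of \<open>y'\<close>, hence equal to \<open>y\<close>.\<close>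

lemma add_neg_defined_imp_induced:
  assumes x: "x \<in> E" and y: "y \<in> E" and d: "add x (neg y) \<noteq> None"
  shows "\<exists>z\<in>E. add x z = Some y"
proof -
  have ny: "neg y \<in> E" by (rule neg_closed[OF y])
  from d obtain s where s: "add x (neg y) = Some s" by blast
  have sE: "s \<in> E" by (rule add_closed[OF x ny s])
  define w where "w = neg s"
  have w: "w \<in> E" unfolding w_def by (rule neg_closed[OF sE])
  have s1: "add s w = Some one" using add_eq_one_iff[OF sE w] w_def by simp
  have "Option.bind (add (neg y) x) (\<lambda>u. add u w) = Some one"
    using s s1 add_commute[OF x ny] by simp
  then have "Option.bind (add x w) (\<lambda>v. add (neg y) v) = Some one"
    using add_assoc[OF ny x w] by simp
  then obtain v where v: "add x w = Some v" "add (neg y) v = Some one"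
    by (auto simp: bind_eq_Some_conv)
  have vE: "v \<in> E" by (rule add_closed[OF x w v(1)])
  \<comment> \<open>That \<open>neg\<close> is an involution has to be derived: \<open>y\<close> and
    \<open>v\<close> are both complements of \<open>neg v\<close>, so uniqueness of complements
    identifies them.\<close>
  have "neg y = neg v" using v(2) add_commute[OF ny vE] add_eq_one_iff[OF vE ny] by simp
  then have "add y (neg v) = Some one" using add_eq_one_iff[OF y ny] by simp
  then have "add (neg v) y = Some one" using add_commute[OF y neg_closed[OF vE]] by simp
  then have "y = neg (neg v)" using add_eq_one_iff[OF neg_closed[OF vE] y] by simp
  moreover have "add (neg v) v = Some one"
    using add_commute[OF vE neg_closed[OF vE]] add_eq_one_iff[OF vE neg_closed[OF vE]] by simp
  then have "v = neg (neg v)" using add_eq_one_iff[OF neg_closed[OF vE] vE] by simp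
  ultimately show ?thesis using v(1) w by auto
qed

text \<open>With \<open>y = z + x\<close>, the sum \<open>(z + x) + y'\<close> equals
  \<open>1\<close>. Associativity makes \<open>z + (x + y')\<close> defined, and with it the inner
  sum.\<close>

lemma induced_imp_add_neg_defined:
  assumes x: "x \<in> E" and y: "y \<in> E" and z: "z \<in> E" and s: "add x z = Some y"
  shows "add x (neg y) \<noteq> None"
proof -
  have ny: "neg y \<in> E" by (rule neg_closed[OF y])
  have "Option.bind (add z x) (\<lambda>u. add u (neg y)) = Some one"
    using s add_commute[OF x z] add_eq_one_iff[OF y ny] by simp
  then show ?thesis using add_assoc[OF z x ny] by (auto simp: bind_eq_Some_conv)
qed

text \<open>Trades the existential witness for a domain condition, which can be compared directly
  with the domain of \<open>dual_add\<close>.\<close>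

lemma induced_order_eq_add_neg_defined:
  "induced_order E add = {(x, y). x \<in> E \<and> y \<in> E \<and> add x (neg y) \<noteq> None}"
  unfolding induced_order_def
  using add_neg_defined_imp_induced induced_imp_add_neg_defined by blast

end

context bounded_involution_poset
begin

lemma rel_subset: "r \<subseteq> C \<times> C"
  using partial_order by (auto simp: partial_order_on_def preorder_on_def)

text \<open>\<open>Above\<close> and \<open>Under\<close> range over \<open>Field r\<close>; this
  turns them into cones in \<open>C\<close>.\<close>

lemma Field_rel: "Field r = C"
  using partial_order rel_subset
  by (auto simp: partial_order_on_def preorder_on_def refl_on_def Field_def)

lemma rel_refl: "x \<in> C \<Longrightarrow> (x, x) \<in> r"
  using partial_order by (auto simp: partial_order_on_def preorder_on_def refl_on_def)

lemma rel_trans: "(x, y) \<in> r \<Longrightarrow> (y, z) \<in> r \<Longrightarrow> (x, z) \<in> r"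
  using partial_order unfolding partial_order_on_def preorder_on_def by (meson transD)

lemma rel_antisym: "(x, y) \<in> r \<Longrightarrow> (y, x) \<in> r \<Longrightarrow> x = y"
  using partial_order unfolding partial_order_on_def by (meson antisymD)

lemma neg_zero: "neg zero = one"
  by (metis neg_antitone neg_closed neg_neg one_closed one_greatest rel_antisym zero_closed
      zero_least)

lemma neg_one: "neg one = zero"
  using neg_neg[OF zero_closed] neg_zero by simp

end

context comm_unsharp_residuated_poset
begin

sublocale bounded_involution_poset C r neg zero one
  by (rule bounded_involution_poset)

sublocale comm_partial_monoid C mult one
  by (rule comm_partial_monoid)

text \<open>At \<open>z = 0\<close> the left side of \<open>residuation\<close> collapses to
  \<open>p = 0\<close> for the product \<open>p\<close> of \<open>x\<close> and \<open>y\<close>,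
  and the right side to \<open>x \<le> y'\<close>. Definedness supplies \<open>y' \<le> x\<close>,
  and antisymmetry finishes.\<close>

lemma mult_eq_zero_iff:
  assumes x: "x \<in> C" and y: "y \<in> C"
  shows "mult x y = Some zero \<longleftrightarrow> x = neg y"
proof (cases "(neg y, x) \<in> r")
  case False
  have "mult y x = None" using False mult_defined_iff[OF y x] by blast
  then show ?thesis using False mult_commute[OF x y] rel_refl[OF x] by auto
next
  case True
  have ny: "neg y \<in> C" by (rule neg_closed[OF y])
  obtain p where p: "mult x y = Some p"
    using True mult_defined_iff[OF y x] mult_commute[OF x y] by auto
  have pC: "p \<in> C" by (rule mult_closed[OF x y p])
  have A: "Above r {x, neg y} = {u \<in> C. (x, u) \<in> r}"
    unfolding Above_def Field_rel using rel_trans[OF True] by blast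
  \<comment> \<open>\<open>p\<close> belongs to the set of products (take the factor
    \<open>x\<close>) and by monotonicity lies below all of them, so the lower cone is the principal
    down-set of \<open>p\<close>.\<close>
  have M: "Under r (set_mult mult (Above r {x, neg y}) y) = {b \<in> C. (b, p) \<in> r}"
  proof -
    have "p \<in> set_mult mult (Above r {x, neg y}) y"
      using p x rel_refl by (auto simp: set_mult_def A)
    moreover have "(p, v) \<in> r" if "v \<in> set_mult mult (Above r {x, neg y}) y" for v
      using that mult_mono[OF x _ y True _ p] by (auto simp: set_mult_def A)
    ultimately show ?thesis unfolding Under_def Field_rel by (blast intro: rel_trans)
  qed
  have N: "Above r (Under r {y, zero}) = C"
  proof -
    have "Under r {y, zero} = {zero}"
      unfolding Under_def Field_rel
      using zero_least[OF y] zero_closed by (blast intro: rel_refl rel_antisym zero_least)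
    then show ?thesis using zero_least by (auto simp: Above_def Field_rel)
  qed
  \<comment> \<open>The down-set contains \<open>p\<close> and the right-hand set contains
    \<open>zero\<close>, which forces \<open>p\<close> below \<open>zero\<close>.\<close>
  have "set_le r {b \<in> C. (b, p) \<in> r} C \<longleftrightarrow> p = zero"
    unfolding set_le_def
    by (metis (no_types, lifting) mem_Collect_eq pC rel_antisym rel_refl rel_trans zero_closed
        zero_least)
  moreover have "set_le r (Under r (Above r {x, neg y})) (Above r (imp y zero)) \<longleftrightarrow> (x, neg y) \<in> r"
  proof
    assume *: "set_le r (Under r (Above r {x, neg y})) (Above r (imp y zero))"
    \<comment> \<open>Testing the hypothesis at \<open>x\<close> on the left and
      \<open>neg y\<close> on the right already gives the claim.\<close>
    have "x \<in> Under r (Above r {x, neg y})" using x by (auto simp: A Under_def Field_rel)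
    moreover have "neg y \<in> Above r (imp y zero)"
      using ny rel_refl by (auto simp: imp_zero[OF y] Above_def Field_rel)
    ultimately show "(x, neg y) \<in> r" using * by (auto simp: set_le_def)
  next
    assume "(x, neg y) \<in> r"
    then show "set_le r (Under r (Above r {x, neg y})) (Above r (imp y zero))"
      unfolding set_le_def imp_zero[OF y] A unfolding Above_def Under_def Field_rel
      using ny by (blast intro: rel_trans)
  qed
  ultimately have "p = zero \<longleftrightarrow> (x, neg y) \<in> r"
    using residuation[OF x y zero_closed] M N by simp
  then show ?thesis using p True rel_antisym[OF _ True] rel_refl[OF x] by auto
qed

text \<open>The product of \<open>neg x\<close> and \<open>neg y\<close> is defined iff
  \<open>x'' = x\<close> lies below \<open>y'\<close>, which is the guard in
  \<open>dual_add\<close>.\<close>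

lemma dual_add_eq:
  assumes "x \<in> C" "y \<in> C"
  shows "dual_add r mult neg x y = map_option neg (mult (neg x) (neg y))"
  using assms mult_defined_iff[of "neg x" "neg y"]
  by (auto simp: dual_add_def neg_neg neg_closed)

lemma dual_add_defined_iff:
  assumes "x \<in> C" "y \<in> C"
  shows "dual_add r mult neg x y \<noteq> None \<longleftrightarrow> (x, neg y) \<in> r"
  using assms mult_defined_iff[of "neg x" "neg y"]
  by (auto simp: dual_add_def neg_neg neg_closed)

lemma dual_add_effect_algebra: "effect_algebra C (dual_add r mult neg) neg zero one"
proof
  show "zero \<in> C" by (rule zero_closed)
  show "one \<in> C" by (rule one_closed)
  show "neg x \<in> C" if "x \<in> C" for x using that by (rule neg_closed)
  show "z \<in> C" if "x \<in> C" "y \<in> C" "dual_add r mult neg x y = Some z" for x y z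
    using that by (auto simp: dual_add_eq intro!: neg_closed intro: mult_closed[of "neg x" "neg y"])
  show "dual_add r mult neg x y = dual_add r mult neg y x" if "x \<in> C" "y \<in> C" for x y
    using that mult_commute[of "neg x" "neg y"] by (simp add: dual_add_eq neg_closed)
  show "Option.bind (dual_add r mult neg x y) (\<lambda>u. dual_add r mult neg u z) =
      Option.bind (dual_add r mult neg y z) (\<lambda>v. dual_add r mult neg x v)"
    if "x \<in> C" "y \<in> C" "z \<in> C" for x y z
  proof -
    note n = that[THEN neg_closed]
    \<comment> \<open>The negation closing the inner sum cancels against the one opening the outer
      sum, leaving a nested product under a single \<open>neg\<close>.\<close>
    have "Option.bind (dual_add r mult neg x y) (\<lambda>u. dual_add r mult neg u z) =
        map_option neg (Option.bind (mult (neg x) (neg y)) (\<lambda>u. mult u (neg z)))"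
      using that mult_closed[OF n(1,2)]
      by (cases "mult (neg x) (neg y)") (auto simp: dual_add_eq neg_closed neg_neg)
    also have "\<dots> = map_option neg (Option.bind (mult (neg y) (neg z)) (\<lambda>v. mult (neg x) v))"
      using mult_assoc[OF n] by simp
    also have "\<dots> = Option.bind (dual_add r mult neg y z) (\<lambda>v. dual_add r mult neg x v)"
      using that mult_closed[OF n(2,3)]
      by (cases "mult (neg y) (neg z)") (auto simp: dual_add_eq neg_closed neg_neg)
    finally show ?thesis .
  qed
  show "dual_add r mult neg x u = Some one \<longleftrightarrow> u = neg x" if "x \<in> C" "u \<in> C" for x u
  proof -
    have "dual_add r mult neg x u = Some one \<longleftrightarrow> mult (neg x) (neg u) = Some zero"
      using that by (auto simp: dual_add_eq neg_zero) (metis mult_closed neg_closed neg_neg neg_one)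
    \<comment> \<open>For the factors \<open>x'\<close> and \<open>u'\<close> the zero-product
      criterion reads \<open>x' = u''\<close>, that is \<open>x' = u\<close>.\<close>
    also have "\<dots> \<longleftrightarrow> u = neg x"
      using that mult_eq_zero_iff[of "neg x" "neg u"] by (auto simp: neg_closed neg_neg)
    finally show ?thesis .
  qed
  show "x = zero" if "x \<in> C" "dual_add r mult neg one x \<noteq> None" for x
  proof -
    have "(one, neg x) \<in> r" using that dual_add_defined_iff one_closed by blast
    then have "neg x = one" using that one_greatest neg_closed rel_antisym by blast
    then show ?thesis using that neg_neg neg_one by metis
  qed
qed

text \<open>Since \<open>y'' = y\<close>, the sum \<open>x + y'\<close> is defined exactly when
  \<open>(x, y)\<close> is in \<open>r\<close>; \<open>r\<close> has no pairs outside
  \<open>C\<close>, so the two relations agree as sets.\<close>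

lemma induced_order_dual_add: "induced_order C (dual_add r mult neg) = r"
proof -
  interpret E: effect_algebra C "dual_add r mult neg" neg zero one
    by (rule dual_add_effect_algebra)
  have "dual_add r mult neg x (neg y) \<noteq> None \<longleftrightarrow> (x, y) \<in> r" if "x \<in> C" "y \<in> C" for x y
    using that dual_add_defined_iff[of x "neg y"] neg_closed neg_neg by simp
  then show ?thesis
    unfolding E.induced_order_eq_add_neg_defined using rel_subset by blast
qed

end

theorem theorem2:
  fixes C :: "'a set"
    and r :: "'a rel"
    and mult :: "'a \<Rightarrow> 'a \<Rightarrow> 'a option"
    and imp :: "'a \<Rightarrow> 'a \<Rightarrow> 'a set"
    and neg :: "'a \<Rightarrow> 'a"
    and zero one :: 'a
  assumes "comm_unsharp_residuated_poset C r mult imp neg zero one"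
  shows "effect_algebra C (dual_add r mult neg) neg zero one
    \<and> induced_order C (dual_add r mult neg) = r"
  using comm_unsharp_residuated_poset.dual_add_effect_algebra[OF assms]
    comm_unsharp_residuated_poset.induced_order_dual_add[OF assms] by blast

end
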